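(* Let $\mathbb P$ be an atomic HTLC-based protocol for a strongly connected swap digraph $G$, and consider its conforming execution. (a) If $P$ is a simple path in $G$ starting at a vertex $x$ whose last contract is protected by $x$, then all contracts on $P$ are protected by $x$. (b) If $Q$ is a simple path in $G$ ending at a vertex $x$ whose first contract is protected by $x$, then all contracts on $Q$ are protected by $x$.
   Context: Swap model: vertices of $G$ are parties; each arc $(u,v)$ is an asset of $u$ (seller) to be transferred to $v$ (buyer). Each party $x$ may create one secret $s_x$ and hashlock $h_x=H(s_x)$ ($H$ a one-way permutation). An HTLC on arc $(u,v)$ is created (at most once) by $u$ with the asset, timeout $\tau_{uv}$ and hashlock $h_x$; the contract is said to be protected by $x$. $v$ obtains the asset by presenting $s_x$ no later than $\tau_{uv}$ (then $u$ learns $s_x$); otherwise it returns to $u$. In an HTLC-based protocol, in each discrete time step any party may create its secret/hashlock pair, create outgoing contracts, and claim incoming assets whose protecting secret it knows; parties can read incoming contracts and may share hashlocks or secrets. Conforming execution: all parties follow $\mathbb P$. Atomic: live (all assets transferred if all conform), safe (every honest party — following $\mathbb P$ until it detects deviation — acquires all incoming assets or relinquishes no outgoing ones, regardless of others), and strong Nash equilibrium. A simple path is a sequence of distinct vertices each with an arc to the next. *)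

theory Defs
  imports "Graph_Theory.Graph_Theory"
begin

text \<open>
  The parties are the vertices of a digraph \<open>G\<close>; an arc \<open>e\<close> is an asset of the seller
  \<open>tail G e\<close>, to be transferred to the buyer \<open>head G e\<close>. Cryptography is idealised: the secret
  and the hashlock of a party \<open>x\<close> are the symbols \<open>Secret x\<close> and \<open>Hashlock x\<close>. Since the hash
  function is public, whoever knows a secret knows its hashlock; since it is one-way, a hashlock
  does not give away its secret.
\<close>

datatype 'v item = Hashlock 'v | Secret 'v

datatype 'v htlc = HTLC (protector: 'v) (timeout: nat)

text \<open>
  A global state. The asset on \<open>e\<close> is in \<open>claimed\<close> iff its buyer has obtained it; otherwise it
  stays with, or eventually returns to, the seller. A triple \<open>(u, v, i)\<close> in \<open>messages\<close> says that
  \<open>u\<close> has shared the item \<open>i\<close> with \<open>v\<close>.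
\<close>

record ('v, 'e) state =
  created_secret :: "'v set"
  contract :: "'e \<Rightarrow> 'v htlc option"
  claimed :: "'e set"
  messages :: "('v \<times> 'v \<times> 'v item) set"

definition init_state :: "('v, 'e) state" where
  "init_state = \<lparr>created_secret = {}, contract = (\<lambda>_. None), claimed = {}, messages = {}\<rparr>"

text \<open>
  Besides its own secret and what it has been sent, a party knows the secrets that were used to
  claim its outgoing contracts, and the hashlocks of its incoming contracts.
\<close>

definition knows_secret ::
    "('v, 'e) pre_digraph \<Rightarrow> ('v, 'e) state \<Rightarrow> 'v \<Rightarrow> 'v \<Rightarrow> bool" where
  "knows_secret G S v x \<longleftrightarrow>
     (x = v \<and> v \<in> created_secret S) \<or>
     (\<exists>u. (u, v, Secret x) \<in> messages S) \<or>
     (\<exists>e \<in> out_arcs G v \<inter> claimed S. \<exists>\<tau>. contract S e = Some (HTLC x \<tau>))"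

definition knows_hashlock ::
    "('v, 'e) pre_digraph \<Rightarrow> ('v, 'e) state \<Rightarrow> 'v \<Rightarrow> 'v \<Rightarrow> bool" where
  "knows_hashlock G S v x \<longleftrightarrow>
     knows_secret G S v x \<or>
     (\<exists>u. (u, v, Hashlock x) \<in> messages S) \<or>
     (\<exists>e \<in> in_arcs G v. \<exists>\<tau>. contract S e = Some (HTLC x \<tau>))"

fun knows_item :: "('v, 'e) pre_digraph \<Rightarrow> ('v, 'e) state \<Rightarrow> 'v \<Rightarrow> 'v item \<Rightarrow> bool" where
  "knows_item G S v (Hashlock x) = knows_hashlock G S v x"
| "knows_item G S v (Secret x) = knows_secret G S v x"

text \<open>
  What a party attempts to do in one time step. Attempts that the rules of the model do not permit
  have no effect, see \<open>step\<close>.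
\<close>

record ('v, 'e) move =
  create_secret :: bool
  create_contract :: "'e \<Rightarrow> 'v htlc option"
  claim :: "'e set"
  share :: "'v \<Rightarrow> 'v item set"

text \<open>
  All parties move simultaneously, on the basis of the state \<open>S\<close> at the beginning of time step \<open>t\<close>;
  the effects are visible from step \<open>t + 1\<close> on, except that a party can use a secret/hashlock pair
  of its own already in the step in which it creates it.
\<close>

definition step ::
    "('v, 'e) pre_digraph \<Rightarrow> nat \<Rightarrow> ('v \<Rightarrow> ('v, 'e) move) \<Rightarrow> ('v, 'e) state \<Rightarrow> ('v, 'e) state" where
  "step G t m S =
     (let S' = S\<lparr>created_secret := created_secret S \<union> {v \<in> verts G. create_secret (m v)}\<rparr> in
      \<lparr>created_secret = created_secret S',
       contract = (\<lambda>e.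
         if contract S e \<noteq> None \<or> e \<notin> arcs G then contract S e
         else (case create_contract (m (tail G e)) e of
                 None \<Rightarrow> None
               | Some c \<Rightarrow>
                   if knows_hashlock G S' (tail G e) (protector c) then Some c else None)),
       claimed = claimed S \<union>
         {e \<in> arcs G. e \<in> claim (m (head G e)) \<and>
            (\<exists>x \<tau>. contract S e = Some (HTLC x \<tau>) \<and> t \<le> \<tau> \<and> knows_secret G S' (head G e) x)},
       messages = messages S \<union>
         {(u, v, i). u \<in> verts G \<and> v \<in> verts G \<and> i \<in> share (m u) v \<and> knows_item G S' u i}\<rparr>)"

text \<open>The part of a state that \<open>v\<close> can observe: the contracts on its own arcs, and its own messages.\<close>

definition local_state ::
    "('v, 'e) pre_digraph \<Rightarrow> 'v \<Rightarrow> ('v, 'e) state \<Rightarrow> ('v, 'e) state" where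
  "local_state G v S =
     (let A = in_arcs G v \<union> out_arcs G v in
      \<lparr>created_secret = created_secret S \<inter> {v},
       contract = (\<lambda>e. if e \<in> A then contract S e else None),
       claimed = claimed S \<inter> A,
       messages = {(u, w, i) \<in> messages S. u = v \<or> w = v}\<rparr>)"

text \<open>
  A strategy maps the list of local states observed at the beginning of steps \<open>0, \<dots>, t\<close> to the move
  in step \<open>t\<close>. The strategies of a profile are run against each other; as every deterministic
  sequence of moves is produced by some strategy, quantifying over strategies covers all behaviours,
  including those coordinated with other parties.
\<close>

type_synonym ('v, 'e) strategy = "('v, 'e) state list \<Rightarrow> ('v, 'e) move"

type_synonym ('v, 'e) profile = "'v \<Rightarrow> ('v, 'e) strategy"

primrec history ::
    "('v, 'e) pre_digraph \<Rightarrow> ('v, 'e) profile \<Rightarrow> nat \<Rightarrow> ('v, 'e) state list" where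
  "history G \<sigma> 0 = [init_state]"
| "history G \<sigma> (Suc t) =
     history G \<sigma> t @
       [step G t (\<lambda>v. \<sigma> v (map (local_state G v) (history G \<sigma> t))) (last (history G \<sigma> t))]"

definition state_at ::
    "('v, 'e) pre_digraph \<Rightarrow> ('v, 'e) profile \<Rightarrow> nat \<Rightarrow> ('v, 'e) state" where
  "state_at G \<sigma> t = last (history G \<sigma> t)"

definition view ::
    "('v, 'e) pre_digraph \<Rightarrow> ('v, 'e) profile \<Rightarrow> 'v \<Rightarrow> nat \<Rightarrow> ('v, 'e) state list" where
  "view G \<sigma> v t = map (local_state G v) (history G \<sigma> t)"

definition transferred :: "('v, 'e) pre_digraph \<Rightarrow> ('v, 'e) profile \<Rightarrow> 'e set" where
  "transferred G \<sigma> = (\<Union>t. claimed (state_at G \<sigma> t))"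

text \<open>An outcome of a party: the incoming assets acquired and the outgoing assets relinquished.\<close>

type_synonym 'e outcome = "'e set \<times> 'e set"

definition outcome ::
    "('v, 'e) pre_digraph \<Rightarrow> ('v, 'e) profile \<Rightarrow> 'v \<Rightarrow> 'e outcome" where
  "outcome G \<sigma> v = (in_arcs G v \<inter> transferred G \<sigma>, out_arcs G v \<inter> transferred G \<sigma>)"

definition acceptable :: "('v, 'e) pre_digraph \<Rightarrow> 'v \<Rightarrow> 'e outcome \<Rightarrow> bool" where
  "acceptable G v \<omega> \<longleftrightarrow> fst \<omega> = in_arcs G v \<or> snd \<omega> = {}"

text \<open>
  A protocol is a profile, and its conforming execution is the one in which all parties play it.
  A party detects a deviation when its view is no longer one that occurs in the conforming
  execution; from then on an honest party is not bound by the protocol, and plays \<open>react\<close> instead.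
\<close>

definition honest ::
    "('v, 'e) pre_digraph \<Rightarrow> ('v, 'e) profile \<Rightarrow> ('v, 'e) profile \<Rightarrow> ('v, 'e) profile" where
  "honest G P react v h = (if \<exists>t. h = view G P v t then P v h else react v h)"

definition live :: "('v, 'e) pre_digraph \<Rightarrow> ('v, 'e) profile \<Rightarrow> bool" where
  "live G P \<longleftrightarrow> arcs G \<subseteq> transferred G P"

definition safe ::
    "('v, 'e) pre_digraph \<Rightarrow> ('v, 'e) profile \<Rightarrow> ('v, 'e) profile \<Rightarrow> bool" where
  "safe G P react \<longleftrightarrow>
     (\<forall>v \<in> verts G. \<forall>\<sigma>. \<sigma> v = honest G P react v \<longrightarrow> acceptable G v (outcome G \<sigma> v))"

text \<open>
  \<open>R v \<omega> \<omega>'\<close> reads: \<open>v\<close> finds \<open>\<omega>'\<close> at least as good as \<open>\<omega>\<close>. Acquiring more and relinquishing less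
  is never worse, and completing the swap is strictly better than not trading at all.
\<close>

definition preferences ::
    "('v, 'e) pre_digraph \<Rightarrow> ('v \<Rightarrow> 'e outcome \<Rightarrow> 'e outcome \<Rightarrow> bool) \<Rightarrow> bool" where
  "preferences G R \<longleftrightarrow>
     (\<forall>v \<in> verts G.
        transp_on (Pow (in_arcs G v) \<times> Pow (out_arcs G v)) (R v) \<and>
        (\<forall>I I' J J'. I \<subseteq> I' \<and> I' \<subseteq> in_arcs G v \<and> J' \<subseteq> J \<and> J \<subseteq> out_arcs G v \<longrightarrow>
           R v (I, J) (I', J')) \<and>
        R v ({}, {}) (in_arcs G v, out_arcs G v) \<and>
        (in_arcs G v \<union> out_arcs G v \<noteq> {} \<longrightarrow>
           \<not> R v (in_arcs G v, out_arcs G v) ({}, {})))"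

text \<open>No coalition has a joint deviation from which each of its members strictly gains.\<close>

definition strong_nash ::
    "('v, 'e) pre_digraph \<Rightarrow> ('v \<Rightarrow> 'e outcome \<Rightarrow> 'e outcome \<Rightarrow> bool) \<Rightarrow>
     ('v, 'e) profile \<Rightarrow> ('v, 'e) profile \<Rightarrow> bool" where
  "strong_nash G R P react \<longleftrightarrow>
     \<not> (\<exists>C \<sigma>. C \<subseteq> verts G \<and> C \<noteq> {} \<and>
          (\<forall>v \<in> verts G - C. \<sigma> v = honest G P react v) \<and>
          (\<forall>v \<in> C. R v (outcome G P v) (outcome G \<sigma> v) \<and>
                    \<not> R v (outcome G \<sigma> v) (outcome G P v)))"

definition atomic ::
    "('v, 'e) pre_digraph \<Rightarrow> ('v \<Rightarrow> 'e outcome \<Rightarrow> 'e outcome \<Rightarrow> bool) \<Rightarrow>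
     ('v, 'e) profile \<Rightarrow> bool" where
  "atomic G R P \<longleftrightarrow>
     live G P \<and> (\<exists>react. safe G P react \<and> strong_nash G R P react)"

text \<open>The contract on \<open>e\<close> that is created in the conforming execution of \<open>P\<close> is protected by \<open>x\<close>.\<close>

definition protected_by ::
    "('v, 'e) pre_digraph \<Rightarrow> ('v, 'e) profile \<Rightarrow> 'e \<Rightarrow> 'v \<Rightarrow> bool" where
  "protected_by G P e x \<longleftrightarrow> (\<exists>t \<tau>. contract (state_at G P t) e = Some (HTLC x \<tau>))"

end

theory Submission
  imports Defs
begin

text \<open>
  Let all parties but \<open>w\<close> follow the protocol up to some time
  \<open>t\<close>, and from then on do nothing except pool their knowledge of one secret and claim one asset of
  \<open>w\<close> with it. They succeed if that secret is not the secret of \<open>w\<close>, or if \<open>w\<close> has given it away.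
  Safety then forces every incoming contract of \<open>w\<close> to exist at time \<open>t\<close> already, and to be
  protected by \<open>w\<close>, by the party whose secret was used, or by one whose secret \<open>w\<close> knows. Each of
  these contracts can be used for an attack on its seller, and so on backwards. By strong
  connectivity, the chain reaches all parties, so that all contracts exist at time \<open>t\<close>, unless it
  is stopped by a seller whose own, unreleased, secret started the chain.

  For (a), consider the creation of a contract protected by \<open>x\<close>, when not all contracts exist.
  If the preceding contract on the path is not protected by \<open>x\<close>, the chain of attacks along the path
  does not stop before \<open>x\<close>, and passes it. For (b), if the protector changes
  along the path from \<open>c\<close> to \<open>c'\<close>, then \<open>c'\<close> is the seller at which it changes, and \<open>c'\<close> releases
  its secret only after \<open>c\<close> does. As \<open>x\<close> protects an outgoing contract of its own, a change on a path
  from an \<open>x\<close>-protected contract to \<open>x\<close> would make \<open>x\<close> release its secret after itself.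
\<close>

section \<open>Elementary properties of executions\<close>

text \<open>Knowledge in the intermediate state \<open>S'\<close> of \<open>step\<close>: a party's
  own secret is usable in the step that creates it, anything learned from others only in the
  next.\<close>

definition knows_in_step ::
    "('v, 'e) pre_digraph \<Rightarrow> ('v \<Rightarrow> ('v, 'e) move) \<Rightarrow> ('v, 'e) state \<Rightarrow> 'v \<Rightarrow> 'v \<Rightarrow> bool" where
  "knows_in_step G m S v x \<longleftrightarrow>
     knows_secret G S v x \<or> (x = v \<and> v \<in> verts G \<and> create_secret (m v))"

lemma knows_secret_created_update:
  "knows_secret G (S\<lparr>created_secret := created_secret S \<union> {v \<in> verts G. create_secret (m v)}\<rparr>) v x
     \<longleftrightarrow> knows_in_step G m S v x"
  by (auto simp: knows_secret_def knows_in_step_def)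

lemma created_secret_step:
  "created_secret (step G t m S) = created_secret S \<union> {v \<in> verts G. create_secret (m v)}"
  by (simp add: step_def Let_def)

lemma claimed_step:
  "e \<in> claimed (step G t m S) \<longleftrightarrow>
     e \<in> claimed S \<or>
     (e \<in> arcs G \<and> e \<in> claim (m (head G e)) \<and>
      (\<exists>x \<tau>. contract S e = Some (HTLC x \<tau>) \<and> t \<le> \<tau> \<and> knows_in_step G m S (head G e) x))"
  by (simp add: step_def Let_def knows_secret_created_update)

lemma secret_message_step:
  "(u, v, Secret z) \<in> messages (step G t m S) \<longleftrightarrow>
     (u, v, Secret z) \<in> messages S \<or>
     (u \<in> verts G \<and> v \<in> verts G \<and> Secret z \<in> share (m u) v \<and> knows_in_step G m S u z)"
  by (simp add: step_def Let_def knows_secret_created_update)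

lemma contract_step_keep:
  "contract S e = Some c \<Longrightarrow> contract (step G t m S) e = Some c"
  by (simp add: step_def Let_def)

lemma contract_step_no_create:
  "create_contract (m (tail G e)) e = None \<Longrightarrow> contract (step G t m S) e = contract S e"
  by (auto simp: step_def Let_def)

text \<open>The hashlock check refers only to the seller's own creation and the old state. Hence a
  victim that moves as in the conforming execution creates the same contracts.\<close>

lemma contract_step_local:
  assumes "m (tail G e) = m' (tail G e)"
  shows "contract (step G t m S) e = contract (step G t' m' S) e"
proof -
  have "knows_hashlock G (S\<lparr>created_secret := created_secret S \<union> {v \<in> verts G. create_secret (m v)}\<rparr>)
          (tail G e) x \<longleftrightarrow>
        knows_hashlock G (S\<lparr>created_secret := created_secret S \<union> {v \<in> verts G. create_secret (m' v)}\<rparr>)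
          (tail G e) x" for x
    using assms by (simp add: knows_hashlock_def knows_secret_def)
  then show ?thesis
    using assms by (simp add: step_def Let_def split: option.split)
qed

lemma state_at_0: "state_at G \<sigma> 0 = init_state"
  by (simp add: state_at_def)

lemma state_at_Suc:
  "state_at G \<sigma> (Suc t) = step G t (\<lambda>v. \<sigma> v (view G \<sigma> v t)) (state_at G \<sigma> t)"
  by (simp add: state_at_def view_def)

lemma length_history: "length (history G \<sigma> t) = Suc t"
  by (induction t) auto

lemma length_view: "length (view G \<sigma> v t) = Suc t"
  by (simp add: view_def length_history)

lemma contract_mono:
  "\<lbrakk>t \<le> t'; contract (state_at G \<sigma> t) e = Some c\<rbrakk> \<Longrightarrow> contract (state_at G \<sigma> t') e = Some c"
  by (induction rule: dec_induct) (auto simp: state_at_Suc contract_step_keep)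

lemma contract_unique:
  assumes "contract (state_at G \<sigma> t) e = Some c" "contract (state_at G \<sigma> t') e = Some c'"
  shows "c = c'"
  using assms contract_mono[of t t' G \<sigma> e c] contract_mono[of t' t G \<sigma> e c']
  by (cases "t \<le> t'") auto

lemma claimed_mono:
  "\<lbrakk>t \<le> t'; e \<in> claimed (state_at G \<sigma> t)\<rbrakk> \<Longrightarrow> e \<in> claimed (state_at G \<sigma> t')"
  by (induction rule: dec_induct) (auto simp: state_at_Suc claimed_step)

lemma knows_secret_step:
  assumes "knows_in_step G m S v x"
  shows "knows_secret G (step G t m S) v x"
proof -
  consider "x = v" "v \<in> created_secret S \<union> {v \<in> verts G. create_secret (m v)}"
    | u where "(u, v, Secret x) \<in> messages S"
    | e \<tau> where "e \<in> out_arcs G v \<inter> claimed S" "contract S e = Some (HTLC x \<tau>)"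
    using assms unfolding knows_in_step_def knows_secret_def by blast
  then show ?thesis
  proof cases
    case 1
    then show ?thesis unfolding knows_secret_def created_secret_step by blast
  next
    case 2
    then show ?thesis unfolding knows_secret_def secret_message_step by blast
  next
    case 3
    then have "e \<in> out_arcs G v \<inter> claimed (step G t m S)"
      "contract (step G t m S) e = Some (HTLC x \<tau>)"
      by (auto simp: claimed_step intro: contract_step_keep)
    then show ?thesis unfolding knows_secret_def by blast
  qed
qed

lemma knows_secret_mono:
  "\<lbrakk>t \<le> t'; knows_secret G (state_at G \<sigma> t) v x\<rbrakk> \<Longrightarrow> knows_secret G (state_at G \<sigma> t') v x"
  by (induction rule: dec_induct)
    (auto simp: state_at_Suc intro!: knows_secret_step simp: knows_in_step_def)

lemma claimed_contract:
  assumes "e \<in> claimed (state_at G \<sigma> t)"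
  obtains x \<tau> where "contract (state_at G \<sigma> t) e = Some (HTLC x \<tau>)"
    "knows_secret G (state_at G \<sigma> t) (head G e) x" "e \<in> arcs G"
proof -
  have "\<exists>x \<tau>. contract (state_at G \<sigma> t) e = Some (HTLC x \<tau>) \<and>
          knows_secret G (state_at G \<sigma> t) (head G e) x \<and> e \<in> arcs G"
    using assms
  proof (induction t)
    case 0
    then show ?case by (simp add: state_at_0 init_state_def)
  next
    case (Suc t)
    let ?S = "state_at G \<sigma> t"
    let ?m = "\<lambda>v. \<sigma> v (view G \<sigma> v t)"
    from Suc obtain x \<tau> where "contract ?S e = Some (HTLC x \<tau>)"
        "knows_in_step G ?m ?S (head G e) x" "e \<in> arcs G"
      unfolding state_at_Suc claimed_step knows_in_step_def by blast
    then show ?case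
      unfolding state_at_Suc by (intro exI conjI contract_step_keep knows_secret_step)
  qed
  then show thesis using that by blast
qed

lemma knows_secret_SucE:
  fixes G :: "('v, 'e) pre_digraph" and \<sigma> :: "('v, 'e) profile" and t :: nat
  defines "m \<equiv> \<lambda>v. \<sigma> v (view G \<sigma> v t)" and "S \<equiv> state_at G \<sigma> t"
  assumes "knows_secret G (state_at G \<sigma> (Suc t)) v x"
  obtains (known) "knows_in_step G m S v x"
    | (message) u where "u \<in> verts G" "v \<in> verts G" "Secret x \<in> share (m u) v"
        "knows_in_step G m S u x"
    | (claim) e \<tau> where "e \<in> out_arcs G v" "contract S e = Some (HTLC x \<tau>)" "t \<le> \<tau>"
        "e \<in> claim (m (head G e))" "knows_in_step G m S (head G e) x"
proof -
  let ?S' = "state_at G \<sigma> (Suc t)"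
  have S': "?S' = step G t m S"
    by (simp add: state_at_Suc m_def S_def)
  consider "x = v" "v \<in> created_secret ?S'"
    | u where "(u, v, Secret x) \<in> messages ?S'"
    | e \<tau> where "e \<in> out_arcs G v" "e \<in> claimed ?S'" "contract ?S' e = Some (HTLC x \<tau>)"
    using assms unfolding knows_secret_def by blast
  then show thesis
  proof cases
    case 1
    then have "knows_in_step G m S v x"
      by (auto simp: S' created_secret_step knows_in_step_def knows_secret_def)
    then show thesis by (rule known)
  next
    case 2
    then consider "(u, v, Secret x) \<in> messages S"
      | "u \<in> verts G" "v \<in> verts G" "Secret x \<in> share (m u) v" "knows_in_step G m S u x"
      unfolding S' secret_message_step by blast
    then show thesis
    proof cases
      case 1
      then have "knows_in_step G m S v x"
        unfolding knows_in_step_def knows_secret_def by blast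
      then show thesis by (rule known)
    next
      case 2
      then show thesis by (rule message)
    qed
  next
    case 3
    show thesis
    proof (cases "e \<in> claimed S")
      case True
      then obtain y \<tau>' where y: "contract S e = Some (HTLC y \<tau>')"
        unfolding S_def by (rule claimed_contract)
      with 3(3) have "y = x" by (simp add: S' contract_step_keep)
      with True y 3(1) have "knows_in_step G m S v x"
        unfolding knows_in_step_def knows_secret_def by blast
      then show thesis by (rule known)
    next
      case False
      with 3(2) obtain y \<tau>' where y: "contract S e = Some (HTLC y \<tau>')" "t \<le> \<tau>'"
          "e \<in> claim (m (head G e))" "knows_in_step G m S (head G e) y"
        unfolding S' claimed_step by blast
      with 3(3) have "y = x" by (simp add: S' contract_step_keep)
      with y 3(1) show thesis by (auto intro: claim)
    qed
  qed
qed

lemma (in wf_digraph) knows_secret_verts: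
  assumes "knows_secret G (state_at G \<sigma> t) v x"
  shows "v \<in> verts G" and "x \<in> verts G"
proof -
  have "knows_secret G (state_at G \<sigma> t) v x \<Longrightarrow> v \<in> verts G \<and> x \<in> verts G" for v x
  proof (induction t arbitrary: v x)
    case 0
    then show ?case by (simp add: state_at_0 init_state_def knows_secret_def)
  next
    case (Suc t)
    have now: "v \<in> verts G \<and> x \<in> verts G"
      if "knows_in_step G m (state_at G \<sigma> t) v x" for m v x
      using that Suc.IH unfolding knows_in_step_def by blast
    from Suc.prems show ?case
    proof (cases rule: knows_secret_SucE)
      case known
      then show ?thesis by (rule now)
    next
      case (message u)
      then show ?thesis using now by blast
    next
      case (claim e \<tau>)
      then show ?thesis using now[OF claim(5)] by auto
    qed
  qed
  then show "v \<in> verts G" "x \<in> verts G" using assms by auto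
qed

lemma history_eq:
  assumes "\<And>s v. s < t \<Longrightarrow> \<sigma> v (view G P v s) = P v (view G P v s)"
  shows "s \<le> t \<Longrightarrow> history G \<sigma> s = history G P s"
proof (induction s)
  case (Suc s)
  then show ?case using assms[of s] by (simp add: view_def)
qed simp

section \<open>The attack on a single honest party\<close>

locale live_safe_protocol = digraph G for G :: "('v, 'e) pre_digraph" +
  fixes P react :: "('v, 'e) profile"
  assumes live: "live G P" and safe: "safe G P react"
begin

definition released :: "nat \<Rightarrow> 'v \<Rightarrow> bool" where
  "released t x \<longleftrightarrow> (\<exists>q. q \<noteq> x \<and> knows_secret G (state_at G P t) q x)"

text \<open>What safety requires of the victim of an attack: it must be able to claim with its own
  secret, those it has at \<open>t\<close>, and the one that the attack reveals.\<close>

definition secured :: "nat \<Rightarrow> 'v \<Rightarrow> 'v \<Rightarrow> bool" where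
  "secured t w p \<longleftrightarrow>
     (\<forall>f \<in> in_arcs G w. \<exists>z \<tau>. contract (state_at G P t) f = Some (HTLC z \<tau>) \<and>
        (z = w \<or> z = p \<or> knows_secret G (state_at G P t) w z))"

text \<open>Forbidden attempts have no effect, so all attackers can make the same move. They create
  secrets since \<open>p\<close> may not have done so yet.\<close>

definition attack_move :: "'e \<Rightarrow> 'v \<Rightarrow> ('v, 'e) move" where
  "attack_move e p =
     \<lparr>create_secret = True, create_contract = (\<lambda>_. None), claim = {e}, share = (\<lambda>_. {Secret p})\<rparr>"

text \<open>A view at step \<open>s\<close> has length \<open>s + 1\<close>, so the attackers
  deviate from step \<open>t\<close> on. The victim's view at \<open>t\<close> is still conforming,
  so it makes its protocol move once more: the attacked contract may first appear at
  \<open>Suc t\<close>.\<close>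

definition attack :: "'v \<Rightarrow> 'e \<Rightarrow> 'v \<Rightarrow> nat \<Rightarrow> ('v, 'e) profile" where
  "attack w e p t v h =
     (if v = w then honest G P react w h
      else if length h \<le> t then P v h else attack_move e p)"

lemma released_mono: "\<lbrakk>t \<le> t'; released t x\<rbrakk> \<Longrightarrow> released t' x"
  unfolding released_def by (blast intro: knows_secret_mono)

lemma in_arcs_tail_neq: "f \<in> in_arcs G w \<Longrightarrow> tail G f \<noteq> w"
  using no_loops[of f] by simp

lemma out_arcs_head_neq: "e \<in> out_arcs G w \<Longrightarrow> head G e \<noteq> w"
  using no_loops[of e] by simp

lemma attack_before:
  assumes "s \<le> t"
  shows "state_at G (attack w e p t) s = state_at G P s"
    and "view G (attack w e p t) v s = view G P v s"
proof -
  have "history G (attack w e p t) s = history G P s"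
    by (rule history_eq[OF _ assms]) (auto simp: attack_def length_view honest_def)
  then show "state_at G (attack w e p t) s = state_at G P s"
    and "view G (attack w e p t) v s = view G P v s"
    by (simp_all add: state_at_def view_def)
qed

lemma attack_moves:
  "\<lbrakk>t \<le> s; v \<noteq> w\<rbrakk> \<Longrightarrow> attack w e p t v (view G (attack w e p t) v s) = attack_move e p"
  by (simp add: attack_def length_view)

lemma attack_victim_move:
  "attack w e p t w (view G (attack w e p t) w t) = P w (view G P w t)"
proof -
  have "attack w e p t w (view G P w t) = P w (view G P w t)"
    by (auto simp: attack_def honest_def)
  then show ?thesis by (simp add: attack_before)
qed

lemma attack_in_contract:
  assumes "t \<le> s" "f \<in> in_arcs G w"
  shows "contract (state_at G (attack w e p t) s) f = contract (state_at G P t) f"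
  using assms(1)
proof (induction s rule: dec_induct)
  case base
  then show ?case by (simp add: attack_before)
next
  case (step s)
  then show ?case
    using in_arcs_tail_neq[OF assms(2)]
    by (simp add: state_at_Suc contract_step_no_create attack_moves attack_move_def)
qed

text \<open>Attackers send no secret but that of \<open>p\<close> and claim no asset but
  \<open>e\<close>, which reveals the same secret.\<close>

lemma attack_victim_knowledge:
  assumes e: "e \<in> out_arcs G w"
    and con: "contract (state_at G (attack w e p t) (Suc t)) e = Some (HTLC p \<tau>)"
    and "t \<le> s" "knows_secret G (state_at G (attack w e p t) s) w z"
  shows "z = w \<or> z = p \<or> knows_secret G (state_at G P t) w z"
  using assms(3,4)
proof (induction s arbitrary: z rule: dec_induct)
  case base
  then show ?case by (simp add: attack_before)
next
  case (step s)
  have now: ?case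
    if "knows_in_step G m (state_at G (attack w e p t) s) w z" for m
    using that step.IH unfolding knows_in_step_def by blast
  from step.prems show ?case
  proof (cases rule: knows_secret_SucE)
    case known
    then show ?thesis by (rule now)
  next
    case (message u)
    show ?thesis
    proof (cases "u = w")
      case True
      then show ?thesis using message now by blast
    next
      case False
      then have "z = p"
        using message step.hyps by (simp add: attack_moves attack_move_def)
      then show ?thesis by blast
    qed
  next
    case (claim f \<tau>')
    from claim(1) have "head G f \<noteq> w" by (rule out_arcs_head_neq)
    then have "f = e"
      using claim step.hyps by (simp add: attack_moves attack_move_def)
    then have "z = p"
      using con claim(2) by (auto dest: contract_unique)
    then show ?thesis by blast
  qed
qed

lemma claim_step:
  assumes "e \<in> arcs G"
  obtains t x \<tau> where "contract (state_at G P t) e = Some (HTLC x \<tau>)" "t \<le> \<tau>"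
    "e \<in> claimed (state_at G P (Suc t))"
    "knows_in_step G (\<lambda>v. P v (view G P v t)) (state_at G P t) (head G e) x"
    "knows_secret G (state_at G P (Suc t)) (head G e) x"
proof -
  obtain T where T: "e \<in> claimed (state_at G P T)"
    using live assms unfolding live_def transferred_def by blast
  have "e \<notin> claimed (state_at G P 0)"
    by (simp add: state_at_0 init_state_def)
  then obtain t where t: "e \<notin> claimed (state_at G P t)" "e \<in> claimed (state_at G P (Suc t))"
    using T by (induction T) auto
  then obtain x \<tau> where x: "contract (state_at G P t) e = Some (HTLC x \<tau>)" "t \<le> \<tau>"
    "knows_in_step G (\<lambda>v. P v (view G P v t)) (state_at G P t) (head G e) x"
    unfolding state_at_Suc claimed_step by blast
  have "knows_secret G (state_at G P (Suc t)) (head G e) x"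
    unfolding state_at_Suc using x(3) by (rule knows_secret_step)
  with x t show thesis by (blast intro: that)
qed

text \<open>In step \<open>t\<close>, \<open>w\<close> reveals what it reveals in the conforming
  execution. Any other source already knows the secret and, as an attacker, shares it with
  everyone.\<close>

lemma attack_keeps_release:
  assumes "knows_secret G (state_at G P (Suc t)) q w" "q \<noteq> w"
  shows "knows_secret G (state_at G (attack w e w t) (Suc t)) q w"
proof -
  let ?S = "state_at G P t" and ?\<sigma> = "attack w e w t"
  let ?m = "\<lambda>v. P v (view G P v t)"
  define m' where "m' = (\<lambda>v. ?\<sigma> v (view G ?\<sigma> v t))"
  have S': "state_at G ?\<sigma> (Suc t) = step G t m' ?S"
    by (simp add: state_at_Suc attack_before m'_def)
  have m'w: "m' w = P w (view G P w t)"
    by (simp add: m'_def attack_victim_move)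
  have m'v: "m' v = attack_move e w" if "v \<noteq> w" for v
    using that by (simp add: m'_def attack_moves)
  have q: "q \<in> verts G" using assms(1) by (rule knows_secret_verts)
  have known_now: "knows_in_step G m' ?S v w" if "knows_in_step G ?m ?S v w" for v
    using that m'w by (auto simp: knows_in_step_def)
  have shared: "knows_secret G (state_at G ?\<sigma> (Suc t)) q w"
    if "v \<in> verts G" "Secret w \<in> share (m' v) q" "knows_in_step G m' ?S v w" for v
    using that q unfolding S' knows_secret_def[of _ "step G t m' ?S"] secret_message_step by blast
  from assms(1) show ?thesis
  proof (cases rule: knows_secret_SucE)
    case known
    from known show ?thesis
      unfolding S' by (intro knows_secret_step known_now)
  next
    case (message u)
    have "Secret w \<in> share (m' u) q"
      using message(3) m'w m'v[of u] by (cases "u = w") (simp_all add: attack_move_def)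
    then show ?thesis
      using message by (intro shared[of u] known_now)
  next
    case (claim f \<tau>)
    show ?thesis
    proof (cases "head G f = w")
      case True
      then have "f \<in> claimed (step G t m' ?S)"
        using claim(1-4) known_now[OF claim(5)] m'w unfolding claimed_step by auto
      moreover have "contract (step G t m' ?S) f = Some (HTLC w \<tau>)"
        using claim(2) by (rule contract_step_keep)
      ultimately show ?thesis
        using claim(1) unfolding S' knows_secret_def by blast
    next
      case False
      then have "Secret w \<in> share (m' (head G f)) q"
        by (simp add: m'v attack_move_def)
      moreover have "head G f \<in> verts G"
        using claim(1) by auto
      ultimately show ?thesis
        using known_now[OF claim(5)] by (intro shared)
    qed
  qed
qed

text \<open>The issue is the timeout, which is at least the step \<open>t'\<close> of the conforming
  claim. A secret other than that of \<open>w\<close> can be created and sent in step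
  \<open>t\<close>, in time for a claim in step \<open>t + 1\<close>.\<close>

lemma attack_claims:
  assumes e: "e \<in> out_arcs G w"
    and con: "contract (state_at G P (Suc t)) e = Some (HTLC p \<tau>)"
    and rel: "p \<noteq> w \<or> released (Suc t) w"
  shows "e \<in> transferred G (attack w e p t)"
    and "contract (state_at G (attack w e p t) (Suc t)) e = Some (HTLC p \<tau>)"
proof -
  let ?\<sigma> = "attack w e p t" and ?h = "head G e"
  let ?D = "state_at G ?\<sigma>" and ?S = "state_at G P"
  let ?m = "\<lambda>s v. ?\<sigma> v (view G ?\<sigma> v s)"
  have eG: "e \<in> arcs G" and tail: "tail G e = w" and h: "?h \<noteq> w" "?h \<in> verts G"
    using e out_arcs_head_neq[OF e] by auto
  have D_Suc: "?D (Suc s) = step G s (?m s) (?D s)" for s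
    by (rule state_at_Suc)
  have Dt: "?D t = ?S t" by (simp add: attack_before)
  have m: "?m s v = attack_move e p" if "t \<le> s" "v \<noteq> w" for s v
    using that by (rule attack_moves)
  have "contract (?D (Suc t)) e = contract (?S (Suc t)) e"
    unfolding D_Suc state_at_Suc[of G P] Dt
    by (rule contract_step_local) (simp add: tail attack_victim_move)
  with con show conD: "contract (?D (Suc t)) e = Some (HTLC p \<tau>)" by simp
  have claims: "e \<in> transferred G ?\<sigma>"
    if "t \<le> s" "contract (?D s) e = Some (HTLC p \<tau>)" "s \<le> \<tau>"
      "knows_in_step G (?m s) (?D s) ?h p" for s
  proof -
    have "e \<in> claimed (?D (Suc s))"
      unfolding D_Suc claimed_step using that eG h m[of s ?h] by (auto simp: attack_move_def)
    then show ?thesis unfolding transferred_def by blast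
  qed
  have shares: "knows_secret G (?D (Suc s)) ?h p"
    if "t \<le> s" "q \<in> verts G" "q \<noteq> w" "knows_in_step G (?m s) (?D s) q p" for s q
  proof -
    have "(q, ?h, Secret p) \<in> messages (?D (Suc s))"
      unfolding D_Suc secret_message_step using that h m[of s q] by (auto simp: attack_move_def)
    then show ?thesis unfolding knows_secret_def by blast
  qed
  obtain t' x \<tau>' where t': "contract (?S t') e = Some (HTLC x \<tau>')" "t' \<le> \<tau>'"
      "e \<in> claimed (?S (Suc t'))" "knows_in_step G (\<lambda>v. P v (view G P v t')) (?S t') ?h x"
      "knows_secret G (?S (Suc t')) ?h x"
    using eG by (rule claim_step)
  have x: "x = p" "\<tau>' = \<tau>"
    using t'(1) con by (auto dest: contract_unique)
  show "e \<in> transferred G ?\<sigma>"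
  proof (cases "t' \<le> t")
    case True
    show ?thesis
    proof (cases "t' = t")
      case True
      have "knows_in_step G (?m t) (?D t) ?h p"
        using t'(4) h m[of t ?h] unfolding Dt True x knows_in_step_def
        by (auto simp: attack_move_def)
      then show ?thesis
        using claims[of t] t'(1,2) True x Dt by simp
    next
      case False
      with \<open>t' \<le> t\<close> have "e \<in> claimed (?S t)"
        using t'(3) by (intro claimed_mono[of "Suc t'" t]) auto
      then show ?thesis unfolding transferred_def Dt[symmetric] by blast
    qed
  next
    case False
    then have \<tau>: "Suc t \<le> \<tau>" using t'(2) x by simp
    show ?thesis
    proof (cases "p = w")
      case False
      have "p \<in> verts G"
        using t'(5) x knows_secret_verts by blast
      then have "knows_secret G (?D (Suc t)) ?h p"
        using shares[of t p] m[of t p] False by (auto simp: knows_in_step_def attack_move_def)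
      then show ?thesis
        using claims[of "Suc t"] conD \<tau> by (simp add: knows_in_step_def)
    next
      case True
      then obtain q where q: "q \<noteq> w" "knows_secret G (?S (Suc t)) q w"
        using rel unfolding released_def by blast
      have keep: "knows_secret G (?D (Suc t)) v p"
        if "v \<noteq> w" "knows_secret G (?S (Suc t)) v w" for v
        using attack_keeps_release[OF that(2,1)] True by simp
      \<comment> \<open>Passing the secret from \<open>q\<close> to the buyer delays the claim to
        step \<open>t + 2\<close>. If the conforming claim comes in step \<open>t + 1\<close>, the
        buyer itself already knows the secret.\<close>
      show ?thesis
      proof (cases "t' = Suc t")
        case True
        then have "knows_secret G (?S (Suc t)) ?h w"
          using t'(4) x h \<open>p = w\<close> unfolding knows_in_step_def by auto
        then show ?thesis
          using claims[of "Suc t"] conD \<tau> keep[of ?h] h by (simp add: knows_in_step_def)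
      next
        case False
        with \<open>\<not> t' \<le> t\<close> have "Suc (Suc t) \<le> \<tau>" using t'(2) x by simp
        moreover have "knows_secret G (?D (Suc (Suc t))) ?h p"
          using shares[of "Suc t" q] keep[of q] q knows_secret_verts(1)[OF q(2)]
          by (simp add: knows_in_step_def)
        moreover have "contract (?D (Suc (Suc t))) e = Some (HTLC p \<tau>)"
          by (rule contract_mono[OF _ conD]) simp
        ultimately show ?thesis
          using claims[of "Suc (Suc t)"] by (simp add: knows_in_step_def)
      qed
    qed
  qed
qed

text \<open>The attack makes \<open>w\<close> relinquish \<open>e\<close>, so safety forces it to
  acquire all incoming assets, whose sellers create nothing from \<open>t\<close> on.\<close>

lemma secured_if_vulnerable:
  assumes e: "e \<in> out_arcs G w"
    and con: "contract (state_at G P (Suc t)) e = Some (HTLC p \<tau>)"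
    and rel: "p \<noteq> w \<or> released (Suc t) w"
  shows "secured t w p"
proof -
  let ?\<sigma> = "attack w e p t"
  note claims = attack_claims[OF e con rel]
  have w: "w \<in> verts G" using e by auto
  have "?\<sigma> w = honest G P react w"
    by (rule ext) (simp add: attack_def)
  then have "acceptable G w (outcome G ?\<sigma> w)"
    using safe w unfolding safe_def by blast
  then have acq: "in_arcs G w \<subseteq> transferred G ?\<sigma>"
    using claims(1) e unfolding acceptable_def outcome_def by auto
  show ?thesis
    unfolding secured_def
  proof
    fix f assume f: "f \<in> in_arcs G w"
    then obtain s where "f \<in> claimed (state_at G ?\<sigma> s)"
      using acq unfolding transferred_def by blast
    then have "f \<in> claimed (state_at G ?\<sigma> (max s t))"
      by (rule claimed_mono[rotated]) simp
    then obtain z \<tau>' where z: "contract (state_at G ?\<sigma> (max s t)) f = Some (HTLC z \<tau>')"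
        "knows_secret G (state_at G ?\<sigma> (max s t)) (head G f) z"
      by (rule claimed_contract)
    have "contract (state_at G P t) f = Some (HTLC z \<tau>')"
      using z(1) attack_in_contract[OF _ f, of t "max s t"] by simp
    moreover have "z = w \<or> z = p \<or> knows_secret G (state_at G P t) w z"
      using attack_victim_knowledge[OF e claims(2), of "max s t" z] z(2) f by simp
    ultimately show "\<exists>z \<tau>. contract (state_at G P t) f = Some (HTLC z \<tau>) \<and>
        (z = w \<or> z = p \<or> knows_secret G (state_at G P t) w z)"
      by blast
  qed
qed

section \<open>Propagating vulnerability backwards\<close>

text \<open>
  If \<open>a\<close> is vulnerable to a claim with the secret of \<open>p\<^sub>0\<close>, then each of its incoming contracts
  makes its seller vulnerable in turn, unless the seller protects the contract itself and has not
  released its secret.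
\<close>

inductive exposed :: "nat \<Rightarrow> 'v \<Rightarrow> 'v \<Rightarrow> 'v \<Rightarrow> 'v \<Rightarrow> bool" for t a p\<^sub>0 where
  base: "exposed t a p\<^sub>0 a p\<^sub>0"
| step: "\<lbrakk>exposed t a p\<^sub>0 w y; f \<in> in_arcs G w; contract (state_at G P t) f = Some (HTLC z \<tau>);
          z \<noteq> tail G f \<or> released t z\<rbrakk> \<Longrightarrow> exposed t a p\<^sub>0 (tail G f) z"

lemma exposed_secured:
  assumes "secured t a p\<^sub>0" "exposed t a p\<^sub>0 w y"
  shows "secured t w y"
  using assms(2)
proof cases
  case base
  then show ?thesis using assms(1) by simp
next
  case (step w' y' f \<tau>)
  have "contract (state_at G P (Suc t)) f = Some (HTLC y \<tau>)"
    by (rule contract_mono[OF _ step(4)]) simp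
  then show ?thesis
  proof (rule secured_if_vulnerable[rotated])
    show "f \<in> out_arcs G w" using step by simp
    show "y \<noteq> w \<or> released (Suc t) w"
      using step released_mono[of t "Suc t" w] by auto
  qed
qed

lemma secured_contract:
  assumes "secured t w p" "f \<in> in_arcs G w"
  obtains z \<tau> where "contract (state_at G P t) f = Some (HTLC z \<tau>)"
    "z = w \<or> z = p \<or> released t z"
proof -
  obtain z \<tau> where "contract (state_at G P t) f = Some (HTLC z \<tau>)"
    "z = w \<or> z = p \<or> knows_secret G (state_at G P t) w z"
    using assms unfolding secured_def by blast
  moreover from this(2) have "z = w \<or> z = p \<or> released t z"
    unfolding released_def by auto
  ultimately show thesis by (intro that)
qed

text \<open>Each link uses the secret of the party just passed, that of the previous link, or a
  released one. So no unreleased secret enters the chain before its owner is exposed, except that of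
  \<open>p\<^sub>0\<close>.\<close>

lemma exposed_origin:
  assumes "secured t a p\<^sub>0" "exposed t a p\<^sub>0 w y"
  shows "y = p\<^sub>0 \<or> released t y \<or> (\<exists>y'. exposed t a p\<^sub>0 y y')"
  using assms(2)
proof induction
  case base
  then show ?case by simp
next
  case (step w y f z \<tau>)
  have "secured t w y"
    using assms(1) step.hyps(1) by (rule exposed_secured)
  then obtain z' \<tau>' where "contract (state_at G P t) f = Some (HTLC z' \<tau>')"
      "z' = w \<or> z' = y \<or> released t z'"
    using step.hyps(2) by (rule secured_contract)
  then have "z = w \<or> z = y \<or> released t z"
    using step.hyps(3) by auto
  then show ?case
    using step.hyps(1) step.IH by auto
qed

text \<open>The chain stops only at a seller whose own unreleased secret is in use. If not yet
  exposed, that seller is \<open>p\<^sub>0\<close> by \<open>exposed_origin\<close>, and each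
  alternative of \<open>cont\<close> excludes this.\<close>

lemma all_contracts_exist:
  assumes "strongly_connected G"
    and a: "a \<in> verts G" "secured t a p\<^sub>0"
    and cont: "released t p\<^sub>0 \<or> (\<exists>y. exposed t a p\<^sub>0 p\<^sub>0 y) \<or>
      (\<forall>f \<in> out_arcs G p\<^sub>0. \<forall>\<tau>. contract (state_at G P t) f \<noteq> Some (HTLC p\<^sub>0 \<tau>))"
    and f: "f \<in> arcs G"
  shows "contract (state_at G P t) f \<noteq> None"
proof -
  have exposed: "\<exists>y. exposed t a p\<^sub>0 w y" if "w \<in> verts G" for w
  proof -
    have "w \<rightarrow>\<^sup>*\<^bsub>G\<^esub> a"
      using assms(1) a(1) that by auto
    then show ?thesis
    proof (induction rule: converse_reachable_induct)
      case base
      then show ?case by (blast intro: exposed.base)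
    next
      case (step u w)
      then obtain y where y: "exposed t a p\<^sub>0 w y" by blast
      obtain g where g: "g \<in> in_arcs G w" "tail G g = u"
        using step.hyps(1) by (auto simp: arcs_ends_conv)
      have uw: "u \<noteq> w" using in_arcs_tail_neq[OF g(1)] g(2) by simp
      have "secured t w y" using a(2) y by (rule exposed_secured)
      then obtain z \<tau> where z: "contract (state_at G P t) g = Some (HTLC z \<tau>)"
          "z = w \<or> z = y \<or> released t z"
        using g(1) by (rule secured_contract)
      show ?case
      proof (cases "z \<noteq> u \<or> released t z")
        case True
        then show ?thesis using exposed.step[OF y g(1) z(1)] g(2) by auto
      next
        case False
        then have "z = u" "y = u" "\<not> released t u"
          using z(2) uw by auto
        moreover have "g \<in> out_arcs G u" using g by auto
        ultimately show ?thesis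
          using exposed_origin[OF a(2) y] cont z(1) by blast
      qed
    qed
  qed
  have "f \<in> in_arcs G (head G f)" "head G f \<in> verts G"
    using f by auto
  then show ?thesis
    using exposed[of "head G f"] exposed_secured[OF a(2)] unfolding secured_def by fastforce
qed

text \<open>A released secret makes the seller of \<open>e\<close> vulnerable and cannot stop the
  chain. Thus, while some contract is missing, the protectors of existing contracts hold back their
  secrets.\<close>

lemma all_contracts_exist_if_released:
  assumes "strongly_connected G" "e \<in> arcs G"
    and con: "contract (state_at G P t) e = Some (HTLC p \<tau>)" and rel: "released t p"
    and "f \<in> arcs G"
  shows "contract (state_at G P t) f \<noteq> None"
proof (rule all_contracts_exist[OF assms(1)])
  have "contract (state_at G P (Suc t)) e = Some (HTLC p \<tau>)"
    by (rule contract_mono[OF _ con]) simp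
  then show "secured t (tail G e) p"
  proof (rule secured_if_vulnerable[rotated])
    show "p \<noteq> tail G e \<or> released (Suc t) (tail G e)"
      using rel released_mono[of t "Suc t" p] by auto
  qed (use assms in simp)
qed (use assms in auto)

section \<open>The protectors of consecutive contracts\<close>

lemma protected_by_unique:
  "\<lbrakk>protected_by G P e x; protected_by G P e y\<rbrakk> \<Longrightarrow> x = y"
  unfolding protected_by_def by (auto dest: contract_unique)

lemma protector_exists:
  assumes "e \<in> arcs G"
  obtains x where "protected_by G P e x"
  using claim_step[OF assms] unfolding protected_by_def by metis

lemma creation_step:
  assumes "protected_by G P e x"
  obtains t \<tau> where "contract (state_at G P t) e = None"
    "contract (state_at G P (Suc t)) e = Some (HTLC x \<tau>)"
proof -
  obtain T \<tau> where T: "contract (state_at G P T) e = Some (HTLC x \<tau>)"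
    using assms unfolding protected_by_def by blast
  have "contract (state_at G P 0) e = None"
    by (simp add: state_at_0 init_state_def)
  then have "\<exists>t. contract (state_at G P t) e = None \<and>
      contract (state_at G P (Suc t)) e = Some (HTLC x \<tau>)"
    using T by (induction T) (auto, metis not_Some_eq contract_unique)
  then show thesis using that by blast
qed

text \<open>If \<open>x\<close> is not the seller of \<open>e\<close>, consider the creation of
  \<open>e\<close>. The chain from the seller must stop, as \<open>e\<close> did not exist before,
  and it can only stop at an outgoing contract that \<open>x\<close> protects.\<close>

lemma protector_has_protected_out_arc:
  assumes "strongly_connected G" "e \<in> arcs G" "protected_by G P e x"
  obtains f where "f \<in> out_arcs G x" "protected_by G P f x"
proof (cases "tail G e = x")
  case True
  then show thesis using assms that[of e] by simp
next
  case False
  obtain t \<tau> where t: "contract (state_at G P t) e = None"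
    "contract (state_at G P (Suc t)) e = Some (HTLC x \<tau>)"
    using assms(3) by (rule creation_step)
  have "secured t (tail G e) x"
    using t(2) by (rule secured_if_vulnerable[rotated]) (use assms False in auto)
  then have "\<exists>f \<in> out_arcs G x. \<exists>\<tau>. contract (state_at G P t) f = Some (HTLC x \<tau>)"
    using all_contracts_exist[OF assms(1) _ _ _ assms(2), of "tail G e" t x] t(1) assms(2) by auto
  then show thesis using that unfolding protected_by_def by blast
qed

text \<open>A strict order by time of first release; a separating time makes irreflexivity
  immediate.\<close>

definition released_before :: "'v \<Rightarrow> 'v \<Rightarrow> bool" where
  "released_before x y \<longleftrightarrow> (\<exists>t. released t x \<and> \<not> released t y)"

lemma released_before_trans:
  "\<lbrakk>released_before x y; released_before y z\<rbrakk> \<Longrightarrow> released_before x z"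
  unfolding released_before_def by (meson linear released_mono)

lemma first_release:
  assumes "e \<in> out_arcs G u" "protected_by G P e u"
  obtains t where "\<not> released t u" "released (Suc t) u"
proof -
  have "e \<in> arcs G" using assms(1) by simp
  then obtain T x \<tau> where T: "contract (state_at G P T) e = Some (HTLC x \<tau>)"
    "knows_secret G (state_at G P (Suc T)) (head G e) x"
    by (rule claim_step)
  then have "x = u"
    using assms(2) protected_by_unique unfolding protected_by_def by blast
  then have "\<exists>T. released T u"
    using T(2) out_arcs_head_neq[OF assms(1)] unfolding released_def by blast
  then obtain T where "released T u" ..
  moreover have "\<not> released 0 u"
    by (simp add: released_def knows_secret_def state_at_0 init_state_def)
  ultimately have "\<exists>t. \<not> released t u \<and> released (Suc t) u"
    by (induction T) auto
  then show thesis using that by blast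
qed

text \<open>
  A buyer \<open>u\<close> who needs the secret of \<open>c\<close> for an incoming contract, but whose outgoing contract is
  protected by someone else, would have to know that secret before creating the latter. So \<open>u\<close> must
  protect the outgoing contract itself, and hold back its own secret until it knows that of \<open>c\<close>.
\<close>

lemma protector_change:
  assumes sc: "strongly_connected G"
    and e': "e' \<in> in_arcs G u" "protected_by G P e' c"
    and e: "e \<in> out_arcs G u" "protected_by G P e c'"
    and c: "c \<noteq> c'" "c \<noteq> u"
  shows "c' = u" and "released_before c u"
proof -
  have c_released: "released t c \<and> (\<exists>\<tau>. contract (state_at G P t) e' = Some (HTLC c \<tau>))"
    if "secured t u c'" for t
  proof -
    from that e'(1) obtain z \<tau> where z: "contract (state_at G P t) e' = Some (HTLC z \<tau>)"
      "z = u \<or> z = c' \<or> released t z"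
      by (rule secured_contract)
    moreover have "z = c"
      using z(1) e'(2) protected_by_unique unfolding protected_by_def by blast
    ultimately show ?thesis using c by auto
  qed
  have created: "contract (state_at G P t) e \<noteq> None" if sec: "secured t u c'" for t
    using c_released[OF sec] all_contracts_exist_if_released[OF sc _ _ _, of e' t c _ e] e'(1) e(1)
    by auto
  obtain s \<tau> where s: "contract (state_at G P s) e = None"
    "contract (state_at G P (Suc s)) e = Some (HTLC c' \<tau>)"
    using e(2) by (rule creation_step)
  show c': "c' = u"
  proof (rule ccontr)
    assume "c' \<noteq> u"
    then have "secured s u c'"
      using secured_if_vulnerable[OF e(1) s(2)] by blast
    then show False using created s(1) by blast
  qed
  obtain t where t: "\<not> released t u" "released (Suc t) u"
    using first_release[OF e(1)] e(2) c' by blast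
  have "s \<le> t"
  proof (rule ccontr)
    assume "\<not> s \<le> t"
    then have "released (Suc s) u"
      using t(2) by (intro released_mono[of "Suc t" "Suc s"]) auto
    then have "secured s u c'"
      using secured_if_vulnerable[OF e(1) s(2)] by blast
    then show False using created s(1) by blast
  qed
  then have "contract (state_at G P (Suc t)) e = Some (HTLC c' \<tau>)"
    using contract_mono[OF _ s(2)] by simp
  \<comment> \<open>The secret of \<open>u\<close> is out only at \<open>Suc t\<close>, but
    \<open>secured\<close> speaks of \<open>t\<close>, when that of \<open>c\<close> is released
    already.\<close>
  then have "secured t u c'"
    using secured_if_vulnerable[OF e(1)] t(2) by blast
  then show "released_before c u"
    using c_released t(1) unfolding released_before_def by blast
qed

section \<open>Simple paths\<close>

lemma apath_end:
  assumes "apath u p v" "p \<noteq> []"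
  shows "last p \<in> in_arcs G v" and "v \<notin> tail G ` set p"
proof -
  have "awlast u p = v" "set p \<subseteq> arcs G" "distinct (awalk_verts u p)"
    using assms(1) unfolding apath_def by auto
  then show "last p \<in> in_arcs G v" "v \<notin> tail G ` set p"
    using assms(2) last_in_set[of p] by (auto simp: awalk_verts_conv)
qed

text \<open>While \<open>g\<close> is missing, protectors of existing contracts have not released,
  so each link uses the secret of a party further along the path. As the path is simple, this is
  never the next seller.\<close>

lemma exposed_along_path:
  assumes sc: "strongly_connected G" and sec: "secured t u x"
    and missing: "g \<in> arcs G" "contract (state_at G P t) g = None"
    and "apath b r u" "r \<noteq> []" "\<not> protected_by G P (last r) x"
  shows "\<exists>y \<in> head G ` set r. exposed t u x b y"
  using assms(5-)
proof (induction r arbitrary: b)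
  case (Cons f r)
  have f: "f \<in> arcs G" "tail G f = b" "apath (head G f) r u"
    and b: "b \<notin> set (awalk_verts (head G f) r)"
    using Cons.prems(1) by (auto simp: apath_Cons_iff)
  have heads: "set (awalk_verts (head G f) r) = insert (head G f) (head G ` set r)"
    using f(3) awalk_verts_conv'[of "head G f" r u]
    by (cases r) (auto simp: apath_def awalk_def)
  \<comment> \<open>At the last contract the secret in use is that of \<open>x\<close>, possibly the
    start of the path. It is dropped there, as \<open>x\<close> does not protect this
    contract.\<close>
  have "\<exists>y. exposed t u x (head G f) y \<and>
      (y \<in> head G ` set r \<or> y = x \<and> \<not> protected_by G P f x)"
  proof (cases "r = []")
    case True
    then have "head G f = u" using f(3) by (simp add: apath_Nil_iff)
    then show ?thesis using Cons.prems True exposed.base by auto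
  next
    case False
    then show ?thesis using Cons.IH[OF f(3)] Cons.prems(3) by auto
  qed
  then obtain y where y: "exposed t u x (head G f) y"
    "y \<in> head G ` set r \<or> y = x \<and> \<not> protected_by G P f x"
    by blast
  have "secured t (head G f) y"
    using sec y(1) by (rule exposed_secured)
  moreover have f_in: "f \<in> in_arcs G (head G f)" using f(1) by simp
  ultimately obtain z \<tau> where z: "contract (state_at G P t) f = Some (HTLC z \<tau>)"
    "z = head G f \<or> z = y \<or>
      released t z"
    by (rule secured_contract)
  have "\<not> released t z"
    using all_contracts_exist_if_released[OF sc f(1) z(1) _ missing(1)] missing(2) by blast
  then have zh: "z \<in> head G ` set (f # r)"
    using z y(2) unfolding protected_by_def by auto
  then have "z \<noteq> tail G f"
    using b heads f(2) by auto
  then have "exposed t u x b z"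
    using exposed.step[OF y(1) f_in z(1)] f(2) by simp
  then show ?case using zh by blast
qed simp

text \<open>Otherwise, just before \<open>e\<close> is created, the chain from \<open>u\<close> runs
  back along \<open>r\<close> and exposes \<open>x\<close>, the only place where it could stop. Then
  \<open>e\<close> would exist already.\<close>

lemma previous_contract_protected:
  assumes sc: "strongly_connected G"
    and r: "apath x r u" "r \<noteq> []" and e: "e \<in> out_arcs G u" "protected_by G P e x"
  shows "protected_by G P (last r) x"
proof (rule ccontr)
  assume neg: "\<not> protected_by G P (last r) x"
  have ux: "x \<noteq> u" using r by (auto dest: apath_nonempty_ends)
  obtain t \<tau> where t: "contract (state_at G P t) e = None"
    "contract (state_at G P (Suc t)) e = Some (HTLC x \<tau>)"
    using e(2) by (rule creation_step)
  have sec: "secured t u x"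
    using secured_if_vulnerable[OF e(1) t(2)] ux by blast
  have "e \<in> arcs G" "u \<in> verts G" using e(1) by auto
  moreover have "\<exists>y. exposed t u x x y"
    using exposed_along_path[OF sc sec _ t(1) r neg] calculation by blast
  ultimately show False
    using all_contracts_exist[OF sc _ sec] t(1) by blast
qed

lemma path_from_protector:
  assumes sc: "strongly_connected G"
    and "apath x p y" "p \<noteq> []" "protected_by G P (last p) x" "e \<in> set p"
  shows "protected_by G P e x"
  using assms(2-)
proof (induction p arbitrary: y rule: rev_induct)
  case (snoc f p)
  have f: "f \<in> out_arcs G (tail G f)" "protected_by G P f x"
    and p: "apath x p (tail G f)"
    using snoc.prems(1,3) by (auto simp: apath_append_iff apath_Cons_iff)
  show ?case
  proof (cases "p = []")
    case True
    then show ?thesis using snoc.prems f by simp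
  next
    case False
    then have "protected_by G P (last p) x"
      using previous_contract_protected[OF sc p _ f] by blast
    then show ?thesis
      using snoc.IH[OF p False] snoc.prems(4) f(2) by auto
  qed
qed simp

text \<open>By \<open>protector_change\<close>, each change makes the current seller the protector
  and moves to a later release. Sellers on the path differ from each other and from
  \<open>x\<close>, so the lemma applies at every change.\<close>

lemma path_from_protected_arc:
  assumes sc: "strongly_connected G"
    and "apath y q z" "q \<noteq> []" "protected_by G P (hd q) x" "x \<notin> tail G ` set q"
  shows "(\<forall>e \<in> set q. protected_by G P e x) \<or>
    (\<exists>c \<in> tail G ` set q. protected_by G P (last q) c \<and> released_before x c)"
  using assms(2-)
proof (induction q arbitrary: z rule: rev_induct)
  case (snoc f q)
  have f: "f \<in> arcs G" "f \<in> out_arcs G (tail G f)" and q: "apath y q (tail G f)"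
    using snoc.prems(1) by (auto simp: apath_append_iff apath_Cons_iff)
  obtain c' where c': "protected_by G P f c'"
    using f(1) by (rule protector_exists)
  show ?case
  proof (cases "q = []")
    case True
    then show ?thesis using snoc.prems by simp
  next
    case False
    have last: "last q \<in> in_arcs G (tail G f)"
      using q False by (rule apath_end)
    have tails: "tail G f \<notin> tail G ` set q"
      using q False by (rule apath_end)
    note change = protector_change[OF sc last _ f(2) c']
    consider (same) "\<forall>e \<in> set q. protected_by G P e x"
      | (other) c where "c \<in> tail G ` set q" "protected_by G P (last q) c" "released_before x c"
      using snoc.IH[OF q False] snoc.prems False by auto
    then show ?thesis
    proof cases
      case same
      then show ?thesis
        using change[of x] c' False snoc.prems(4) by (cases "c' = x") auto
    next
      case other
      then have "c \<noteq> tail G f" using tails by metis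
      then show ?thesis
        using change[of c] c' other released_before_trans by (cases "c' = c") auto
    qed
  qed
qed simp

text \<open>A change on the path yields a last protector \<open>c\<close> that releases after
  \<open>x\<close>. Continuing with an outgoing contract that \<open>x\<close> protects gives a
  change from \<open>c\<close> to \<open>x\<close>, so \<open>c\<close> also releases before
  \<open>x\<close>.\<close>

lemma path_to_protector:
  assumes sc: "strongly_connected G"
    and q: "apath y q x" "q \<noteq> []" and hd: "protected_by G P (hd q) x" and "e \<in> set q"
  shows "protected_by G P e x"
proof (rule ccontr)
  assume "\<not> protected_by G P e x"
  have last: "last q \<in> in_arcs G x" and tails: "x \<notin> tail G ` set q"
    using apath_end[OF q] by blast+
  then obtain c where c: "c \<in> tail G ` set q" "protected_by G P (last q) c" "released_before x c"
    using path_from_protected_arc[OF sc q hd] \<open>e \<in> set q\<close> \<open>\<not> protected_by G P e x\<close> by blast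
  have "hd q \<in> arcs G"
    using q by (auto simp: apath_def awalk_def)
  then obtain f where f: "f \<in> out_arcs G x" "protected_by G P f x"
    using protector_has_protected_out_arc[OF sc _ hd] by blast
  have "released_before c x"
    using protector_change(2)[OF sc last c(2) f] c(1) tails by blast
  with c(3) have "released_before x x" by (rule released_before_trans)
  then show False unfolding released_before_def by blast
qed

end

theorem theorem5:
  fixes G :: "('v, 'e) pre_digraph"
    and R :: "'v \<Rightarrow> 'e outcome \<Rightarrow> 'e outcome \<Rightarrow> bool"
    and P :: "('v, 'e) profile"
  assumes "digraph G" and "strongly_connected G"
    and "preferences G R"
    and "atomic G R P"
  shows "(\<forall>x y p. pre_digraph.apath G x p y \<and> p \<noteq> [] \<and> protected_by G P (last p) x \<longrightarrow>
            (\<forall>e \<in> set p. protected_by G P e x)) \<and>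
         (\<forall>x y q. pre_digraph.apath G y q x \<and> q \<noteq> [] \<and> protected_by G P (hd q) x \<longrightarrow>
            (\<forall>e \<in> set q. protected_by G P e x))"
proof -
  obtain react where "live G P" "safe G P react"
    using \<open>atomic G R P\<close> unfolding atomic_def by blast
  then interpret live_safe_protocol G P react
    using \<open>digraph G\<close> by (simp add: live_safe_protocol_def live_safe_protocol_axioms_def)
  show ?thesis
    using path_from_protector path_to_protector \<open>strongly_connected G\<close> by blast
qed

end
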